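(* Let $\Gamma$ be a finite simple graph with vertex set $V_\Gamma$, let $A(\Gamma)$ be the right-angled Artin group (graph group) with defining graph $\Gamma$, let $n$ be a positive integer, and let $z\in V_\Gamma$. Define a homomorphism $\phi: A(\Gamma)\to\langle x \ ;\ x^n=1\rangle\cong\mathbb{Z}/n\mathbb{Z}$ by $\phi(v)=1$ for every vertex $v\neq z$ and $\phi(z)=x$. Then $\ker\phi$ is a right-angled Artin group whose defining graph $\Gamma'$ is obtained by gluing $n$ copies of $\Gamma\setminus st(z)$ to $st(z)$ along $lk(z)$. Moreover, the vertices of $\Gamma'$ naturally correspond to the following generating set of $\ker\phi$: $$\{z^n\}\cup lk(z)\cup\{u : u\notin st(z)\}\cup\{zuz^{-1} : u\notin st(z)\}\cup\cdots\cup\{z^{n-1}uz^{1-n} : u\notin st(z)\}.$$ That is, there is an isomorphism $A(\Gamma')\to\ker\phi$ which sends the vertex $z$ of $\Gamma'$ to $z^n$, each vertex $v\in lk(z)$ to $v$, and, for $0\le k\le n-1$ and $u\in V_\Gamma\setminus st(z)$, the $k$-th copy $u^{(k)}$ of $u$ to $z^k u z^{-k}$.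
   Context: All graphs are finite and simple. For a graph $\Gamma$ with vertex set $V_\Gamma$ and edge set $E_\Gamma$, the right-angled Artin group (also called graph group) with defining graph $\Gamma$ is $$A(\Gamma)=\langle V_\Gamma \ ;\ vwv^{-1}w^{-1}=1 \text{ for all } \{v,w\}\in E_\Gamma\rangle.$$ For a vertex $z$, the link $lk(z)$ is the set of vertices adjacent to $z$ (or the subgraph induced on it), and the star $st(z)$ is $\{z\}\cup lk(z)$ (or the subgraph induced on it). The graph $\Gamma'$ obtained by gluing $n$ copies of $\Gamma\setminus st(z)$ to $st(z)$ along $lk(z)$ is the following graph. Its vertices are $z$, the vertices of $lk(z)$, and $n$ copies $u^{(0)},\dots,u^{(n-1)}$ of each vertex $u\in V_\Gamma\setminus st(z)$. Its edges are: all edges of $\Gamma$ between two vertices of $st(z)$; the edge $\{u^{(k)},v\}$ for each $k$ and each edge $\{u,v\}$ of $\Gamma$ with $u\notin st(z)$, $v\in lk(z)$; and the edge $\{u^{(k)},w^{(k)}\}$ for each $k$ and each edge $\{u,w\}$ of $\Gamma$ with $u,w\notin st(z)$. There are no other edges; in particular, vertices in different copies are not adjacent, and $z$ is adjacent only to vertices of $lk(z)$. *)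

theory Defs
  imports "HOL-Algebra.Algebra" "Graph_Theory.Pair_Digraph"
begin

section \<open>Groups given by presentations\<close>

text \<open>
  The letter \<open>(s, True)\<close> stands for the generator \<open>s\<close> and \<open>(s, False)\<close> for its formal inverse.
\<close>

type_synonym 's word = "('s \<times> bool) list"

definition words :: "'s set \<Rightarrow> 's word set" where
  "words S = lists (S \<times> UNIV)"

text \<open>
  The congruence on words generated by free cancellation and by the relations \<open>r = 1\<close> for
  \<open>r \<in> R\<close>. Relators that are not words over \<open>S\<close> are ignored.
\<close>

inductive pres_eq :: "'s set \<Rightarrow> 's word set \<Rightarrow> 's word \<Rightarrow> 's word \<Rightarrow> bool"
  for S :: "'s set" and R :: "'s word set" where
  refl: "w \<in> words S \<Longrightarrow> pres_eq S R w w"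
| sym: "pres_eq S R v w \<Longrightarrow> pres_eq S R w v"
| trans: "pres_eq S R u v \<Longrightarrow> pres_eq S R v w \<Longrightarrow> pres_eq S R u w"
| cancel: "u \<in> words S \<Longrightarrow> v \<in> words S \<Longrightarrow> s \<in> S \<Longrightarrow>
    pres_eq S R (u @ [(s, b), (s, \<not> b)] @ v) (u @ v)"
| relator: "u \<in> words S \<Longrightarrow> v \<in> words S \<Longrightarrow> r \<in> R \<Longrightarrow> r \<in> words S \<Longrightarrow>
    pres_eq S R (u @ r @ v) (u @ v)"

definition pres_rel :: "'s set \<Rightarrow> 's word set \<Rightarrow> 's word rel" where
  "pres_rel S R = {(v, w). pres_eq S R v w}"

definition presented_group :: "'s set \<Rightarrow> 's word set \<Rightarrow> 's word set monoid" where
  "presented_group S R =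
    \<lparr>carrier = words S // pres_rel S R,
     monoid.mult = (\<lambda>A B. \<Union>v\<in>A. \<Union>w\<in>B. pres_rel S R `` {v @ w}),
     one = pres_rel S R `` {[]}\<rparr>"

definition pres_gen :: "'s set \<Rightarrow> 's word set \<Rightarrow> 's \<Rightarrow> 's word set" where
  "pres_gen S R s = pres_rel S R `` {[(s, True)]}"

lemma words_Nil [simp]: "[] \<in> words S"
  and words_Cons [simp]: "a # w \<in> words S \<longleftrightarrow> fst a \<in> S \<and> w \<in> words S"
  and words_append [simp]: "v @ w \<in> words S \<longleftrightarrow> v \<in> words S \<and> w \<in> words S"
  by (cases a; auto simp: words_def)+

lemma pres_eq_words: "pres_eq S R v w \<Longrightarrow> v \<in> words S \<and> w \<in> words S"
  by (induction rule: pres_eq.induct) auto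

lemma equiv_pres_rel: "equiv (words S) (pres_rel S R)"
proof (rule equivI)
  show "pres_rel S R \<subseteq> words S \<times> words S"
    using pres_eq_words by (fastforce simp: pres_rel_def)
  show "refl_on (words S) (pres_rel S R)"
    by (auto simp: refl_on_def pres_rel_def intro: pres_eq.refl)
  show "sym (pres_rel S R)"
    by (auto simp: sym_def pres_rel_def intro: pres_eq.sym)
  show "trans (pres_rel S R)"
    by (auto simp: trans_def pres_rel_def intro: pres_eq.trans)
qed

lemma pres_eq_append_right:
  "pres_eq S R v w \<Longrightarrow> u \<in> words S \<Longrightarrow> pres_eq S R (v @ u) (w @ u)"
proof (induction rule: pres_eq.induct)
  case (cancel u' v' s b)
  then show ?case using pres_eq.cancel[of u' S "v' @ u" s R b] by simp
next
  case (relator u' v' r)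
  then show ?case using pres_eq.relator[of u' S "v' @ u" r R] by simp
qed (auto intro: pres_eq.intros)

lemma pres_eq_append_left:
  "pres_eq S R v w \<Longrightarrow> u \<in> words S \<Longrightarrow> pres_eq S R (u @ v) (u @ w)"
proof (induction rule: pres_eq.induct)
  case (cancel u' v' s b)
  then show ?case using pres_eq.cancel[of "u @ u'" S v' s R b] by simp
next
  case (relator u' v' r)
  then show ?case using pres_eq.relator[of "u @ u'" S v' r R] by simp
qed (auto intro: pres_eq.intros)

lemma pres_eq_append:
  assumes "pres_eq S R v v'" "pres_eq S R w w'"
  shows "pres_eq S R (v @ w) (v' @ w')"
  using assms pres_eq_append_left pres_eq_append_right pres_eq_words pres_eq.trans by metis

lemma presented_group_mult:
  assumes "v \<in> words S" "w \<in> words S"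
  shows "pres_rel S R `` {v} \<otimes>\<^bsub>presented_group S R\<^esub> pres_rel S R `` {w} = pres_rel S R `` {v @ w}"
proof -
  let ?c = "\<lambda>w. pres_rel S R `` {w}"
  have eq: "?c (v' @ w') = ?c (v @ w)" if "v' \<in> ?c v" "w' \<in> ?c w" for v' w'
  proof -
    have "(v @ w, v' @ w') \<in> pres_rel S R"
      using that by (auto simp: pres_rel_def intro: pres_eq_append)
    from equiv_class_eq[OF equiv_pres_rel this] show ?thesis by (rule HOL.sym)
  qed
  have self: "v \<in> ?c v" "w \<in> ?c w"
    using assms by (auto simp: pres_rel_def intro: pres_eq.refl)
  have "?c v \<otimes>\<^bsub>presented_group S R\<^esub> ?c w = (\<Union>v'\<in>?c v. \<Union>w'\<in>?c w. ?c (v' @ w'))"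
    by (simp add: presented_group_def)
  also have "\<dots> = (\<Union>v'\<in>?c v. \<Union>w'\<in>?c w. ?c (v @ w))"
    by (intro SUP_cong HOL.refl eq)
  also have "\<dots> = ?c (v @ w)"
    using self by blast
  finally show ?thesis .
qed

lemma pres_eq_inverse:
  "w \<in> words S \<Longrightarrow> pres_eq S R (rev (map (\<lambda>(s, b). (s, \<not> b)) w) @ w) []"
proof (induction w)
  case Nil
  then show ?case by (simp add: pres_eq.refl)
next
  case (Cons a w)
  obtain s b where a: "a = (s, b)" by (cases a)
  let ?w' = "rev (map (\<lambda>(s, b). (s, \<not> b)) w)"
  have "?w' \<in> words S" using Cons.IH Cons.prems pres_eq_words by fastforce
  then have "pres_eq S R (?w' @ [(s, \<not> b), (s, \<not> \<not> b)] @ w) (?w' @ w)"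
    using Cons.prems a by (intro pres_eq.cancel) auto
  then show ?case using Cons a pres_eq.trans by fastforce
qed

theorem group_presented_group: "group (presented_group S R)"
proof (rule groupI)
  let ?G = "presented_group S R"
  let ?c = "\<lambda>w. pres_rel S R `` {w}"
  have carr: "carrier ?G = ?c ` words S"
    by (auto simp: presented_group_def quotient_def)
  have one: "\<one>\<^bsub>?G\<^esub> = ?c []" by (simp add: presented_group_def)
  show "\<one>\<^bsub>?G\<^esub> \<in> carrier ?G" by (auto simp: carr one)
  show "x \<otimes>\<^bsub>?G\<^esub> y \<in> carrier ?G" if "x \<in> carrier ?G" "y \<in> carrier ?G" for x y
    using that by (auto simp: carr presented_group_mult)
  show "x \<otimes>\<^bsub>?G\<^esub> y \<otimes>\<^bsub>?G\<^esub> z = x \<otimes>\<^bsub>?G\<^esub> (y \<otimes>\<^bsub>?G\<^esub> z)"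
    if "x \<in> carrier ?G" "y \<in> carrier ?G" "z \<in> carrier ?G" for x y z
    using that by (auto simp: carr presented_group_mult)
  show "\<one>\<^bsub>?G\<^esub> \<otimes>\<^bsub>?G\<^esub> x = x" if "x \<in> carrier ?G" for x
    using that by (auto simp: carr one presented_group_mult)
  show "\<exists>y\<in>carrier ?G. y \<otimes>\<^bsub>?G\<^esub> x = \<one>\<^bsub>?G\<^esub>" if x: "x \<in> carrier ?G" for x
  proof -
    obtain w where w: "w \<in> words S" "x = ?c w" using x by (auto simp: carr)
    let ?w' = "rev (map (\<lambda>(s, b). (s, \<not> b)) w)"
    have eq: "pres_eq S R (?w' @ w) []" using w by (intro pres_eq_inverse)
    then have w': "?w' \<in> words S" using pres_eq_words by fastforce
    have "?c ?w' \<otimes>\<^bsub>?G\<^esub> x = ?c (?w' @ w)" using w w' by (simp add: presented_group_mult)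
    also have "\<dots> = \<one>\<^bsub>?G\<^esub>"
      unfolding one using eq by (intro equiv_class_eq[OF equiv_pres_rel]) (simp add: pres_rel_def)
    finally show ?thesis using w' carr by blast
  qed
qed


section \<open>The cyclic group presented by one generator and the relation $x^n = 1$\<close>

definition cyclic_relators :: "nat \<Rightarrow> unit word set" where
  "cyclic_relators n = {replicate n ((), True)}"

definition cyclic_presentation :: "nat \<Rightarrow> unit word set monoid" where
  "cyclic_presentation n = presented_group {()} (cyclic_relators n)"

definition cyclic_gen :: "nat \<Rightarrow> unit word set" where
  "cyclic_gen n = pres_gen {()} (cyclic_relators n) ()"


section \<open>Right-angled Artin groups\<close>

text \<open>
  Finite simple graphs are rendered by the locale \<open>pair_graph\<close>, i.e. as finite irreflexive
  symmetric digraphs: the edge $\{v,w\}$ is represented by the two arcs \<open>(v, w)\<close> and \<open>(w, v)\<close>.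
\<close>

definition raag_relators :: "'a pair_pre_digraph \<Rightarrow> 'a word set" where
  "raag_relators \<Gamma> = {[(v, True), (w, True), (v, False), (w, False)] | v w. (v, w) \<in> parcs \<Gamma>}"

definition raag :: "'a pair_pre_digraph \<Rightarrow> 'a word set monoid" where
  "raag \<Gamma> = presented_group (pverts \<Gamma>) (raag_relators \<Gamma>)"

definition raag_gen :: "'a pair_pre_digraph \<Rightarrow> 'a \<Rightarrow> 'a word set" where
  "raag_gen \<Gamma> v = pres_gen (pverts \<Gamma>) (raag_relators \<Gamma>) v"


section \<open>Gluing copies of the complement of a star\<close>

definition link :: "'a pair_pre_digraph \<Rightarrow> 'a \<Rightarrow> 'a set" where
  "link \<Gamma> z = {v. (z, v) \<in> parcs \<Gamma>}"

definition star :: "'a pair_pre_digraph \<Rightarrow> 'a \<Rightarrow> 'a set" where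
  "star \<Gamma> z = insert z (link \<Gamma> z)"

datatype 'a glued_vertex = Base 'a | Copy nat 'a

definition glue_copies :: "'a pair_pre_digraph \<Rightarrow> 'a \<Rightarrow> nat \<Rightarrow> 'a glued_vertex pair_pre_digraph" where
  "glue_copies \<Gamma> z n =
    \<lparr>pverts = {Base v | v. v \<in> star \<Gamma> z}
       \<union> {Copy k u | k u. k < n \<and> u \<in> pverts \<Gamma> - star \<Gamma> z},
     parcs = {(Base v, Base w) | v w. (v, w) \<in> parcs \<Gamma> \<and> v \<in> star \<Gamma> z \<and> w \<in> star \<Gamma> z}
       \<union> {(Copy k u, Base v) | k u v. k < n \<and> (u, v) \<in> parcs \<Gamma> \<and> u \<notin> star \<Gamma> z \<and> v \<in> link \<Gamma> z}
       \<union> {(Base v, Copy k u) | k u v. k < n \<and> (v, u) \<in> parcs \<Gamma> \<and> u \<notin> star \<Gamma> z \<and> v \<in> link \<Gamma> z}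
       \<union> {(Copy k u, Copy k w) | k u w. k < n \<and> (u, w) \<in> parcs \<Gamma> \<and> u \<notin> star \<Gamma> z \<and> w \<notin> star \<Gamma> z}\<rparr>"

lemma pair_graph_glue_copies:
  assumes "pair_graph \<Gamma>" "z \<in> pverts \<Gamma>"
  shows "pair_graph (glue_copies \<Gamma> z n)"
proof -
  interpret G: pair_graph \<Gamma> by fact
  let ?H = "glue_copies \<Gamma> z n"
  have wf: "fst e \<in> pverts ?H \<and> snd e \<in> pverts ?H" if "e \<in> parcs ?H" for e
    using that by (auto simp: glue_copies_def star_def dest: G.wellformed')
  have "pverts ?H \<subseteq> Base ` pverts \<Gamma> \<union> case_prod Copy ` ({..<n} \<times> pverts \<Gamma>)"
    using assms(2) by (auto simp: glue_copies_def star_def link_def dest: G.wellformed')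
  then have fin: "finite (pverts ?H)"
    by (rule finite_subset) (simp add: G.pair_finite_verts)
  have fin': "finite (parcs ?H)"
    by (rule finite_subset[of _ "pverts ?H \<times> pverts ?H"]) (use wf fin in auto)
  have "(v, u) \<in> parcs \<Gamma>" if "(u, v) \<in> parcs \<Gamma>" for u v
    using G.pair_sym_arcs that by (auto simp: symmetric_def dest: symD)
  then have sym: "symmetric (with_proj ?H)"
    by (auto simp: symmetric_def sym_def glue_copies_def)
  have "fst e \<noteq> snd e" if "e \<in> parcs ?H" for e
    using that by (auto simp: glue_copies_def dest: G.no_loops')
  with wf fin fin' sym show ?thesis by unfold_locales auto
qed


section \<open>The homomorphism and the generators of its kernel\<close>

definition vertex_hom :: "'a pair_pre_digraph \<Rightarrow> 'a \<Rightarrow> nat \<Rightarrow> ('a word set \<Rightarrow> unit word set) \<Rightarrow> bool" where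
  "vertex_hom \<Gamma> z n \<phi> \<longleftrightarrow>
    \<phi> \<in> hom (raag \<Gamma>) (cyclic_presentation n) \<and>
    (\<forall>v \<in> pverts \<Gamma> - {z}. \<phi> (raag_gen \<Gamma> v) = \<one>\<^bsub>cyclic_presentation n\<^esub>) \<and>
    \<phi> (raag_gen \<Gamma> z) = cyclic_gen n"

definition conj_gen :: "'a pair_pre_digraph \<Rightarrow> 'a \<Rightarrow> nat \<Rightarrow> 'a \<Rightarrow> 'a word set" where
  "conj_gen \<Gamma> z k u =
    raag_gen \<Gamma> z [^]\<^bsub>raag \<Gamma>\<^esub> k \<otimes>\<^bsub>raag \<Gamma>\<^esub> raag_gen \<Gamma> u \<otimes>\<^bsub>raag \<Gamma>\<^esub>
      inv\<^bsub>raag \<Gamma>\<^esub> (raag_gen \<Gamma> z [^]\<^bsub>raag \<Gamma>\<^esub> k)"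

text \<open>The conjugates for \<open>k = 0\<close> are the generators \<open>u\<close> outside the star themselves.\<close>

definition kernel_gens :: "'a pair_pre_digraph \<Rightarrow> 'a \<Rightarrow> nat \<Rightarrow> 'a word set set" where
  "kernel_gens \<Gamma> z n =
    {raag_gen \<Gamma> z [^]\<^bsub>raag \<Gamma>\<^esub> n} \<union> raag_gen \<Gamma> ` link \<Gamma> z
    \<union> {conj_gen \<Gamma> z k u | k u. k < n \<and> u \<in> pverts \<Gamma> - star \<Gamma> z}"

end

theory Submission
  imports Defs
begin

text \<open>
  Write $A = A(\Gamma)$ and $B = A(\Gamma')$, and let $t \in B$ be the generator that belongs to
  the vertex $z$ of $\Gamma'$. The elements $z^n$, $v \in lk(z)$ and $z^k u z^{-k}$ of $A$ satisfy
  the commutation relations of $\Gamma'$: the powers of $z$ commute with $lk(z)$, and conjugation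
  by $z^k$ preserves relations. Von Dyck's theorem (\<open>von_Dyck\<close>, \<open>raag_universal\<close>) therefore gives
  a homomorphism $\psi : B \to A$, and two things remain: $\psi$ is injective, and its image is
  the kernel of $\phi$.

  Injectivity (\<open>gluing_hom_inj\<close>) comes from an action of $A$ on $\{0,\dots,n-1\} \times B$. If
  $B$ is already known to be the kernel, then $1, z^{-1}, \dots, z^{-(n-1)}$ represent its left
  cosets in $A$, and left multiplication of $A$ on itself, read off in the coordinates
  $(i, b) \leftrightarrow z^{-i} b$, is given by formulas that mention only $B$:
  $z \cdot (i, b) = (i - 1, b)$ for $i > 0$, $z \cdot (0, b) = (n - 1, t b)$,
  $v \cdot (i, b) = (i, v b)$ for $v \in lk(z)$, and $u \cdot (i, b) = (i, u^{(i)} b)$ for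
  $u \notin st(z)$. These formulas define bijections which satisfy the relations of $A$, whatever
  the kernel is; so they define an action of $A$. Under it $\psi(g)$ sends $(0, b)$ to
  $(0, g b)$, as is checked on generators, and thus $\psi(g) = 1$ forces $g = 1$.

  The image of $\psi$ is the subgroup $H$ generated by the given elements, and it lies in the
  kernel. Since $H$ contains $z^k v z^{-k}$ for every integer $k$ and every $v \noteq z$
  (\<open>conj_in_generate\<close>), the set of all $h z^k$ with $h \in H$ is closed under right multiplication
  by generators and their inverses, hence is all of $A$ (\<open>generate_times_powers\<close>). An element
  $h z^k$ of the kernel satisfies $x^k = 1$; as $x$ has order exactly $n$, this makes $z^k$ a power
  of $z^n$, and the element lies in $H$ (\<open>kernel_eq_generate\<close>).
\<close>

section \<open>Homomorphisms out of a presented group\<close>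

primrec word_eval :: "('g, 'm) monoid_scheme \<Rightarrow> ('s \<Rightarrow> 'g) \<Rightarrow> 's word \<Rightarrow> 'g" where
  "word_eval G f [] = \<one>\<^bsub>G\<^esub>"
| "word_eval G f (a # w) =
    (if snd a then f (fst a) else inv\<^bsub>G\<^esub> f (fst a)) \<otimes>\<^bsub>G\<^esub> word_eval G f w"

context group
begin

lemma word_eval_closed:
  "f \<in> S \<rightarrow> carrier G \<Longrightarrow> w \<in> words S \<Longrightarrow> word_eval G f w \<in> carrier G"
  by (induction w) (auto simp: Pi_iff)

lemma word_eval_append:
  assumes "f \<in> S \<rightarrow> carrier G" "v \<in> words S" "w \<in> words S"
  shows "word_eval G f (v @ w) = word_eval G f v \<otimes> word_eval G f w"
  using assms(2)
proof (induction v)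
  case Nil
  then show ?case using word_eval_closed[OF assms(1,3)] by simp
next
  case (Cons a v)
  then show ?case
    using word_eval_closed[OF assms(1), of v] word_eval_closed[OF assms(1,3)] assms(1)
    by (auto simp: m_assoc Pi_iff)
qed

lemma word_eval_replicate:
  "f s \<in> carrier G \<Longrightarrow> word_eval G f (replicate k (s, True)) = f s [^] k"
  by (induction k) (simp_all add: group_commutes_pow)

lemma word_eval_respects_pres_eq:
  assumes f: "f \<in> S \<rightarrow> carrier G"
    and R: "\<And>r. r \<in> R \<Longrightarrow> r \<in> words S \<Longrightarrow> word_eval G f r = \<one>"
    and eq: "pres_eq S R v w"
  shows "word_eval G f v = word_eval G f w"
  using eq
proof (induction rule: pres_eq.induct)
  case (cancel u v s b)
  then have "f s \<in> carrier G" using f by auto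
  then have one: "word_eval G f [(s, b), (s, \<not> b)] = \<one>" by simp
  have "word_eval G f (u @ [(s, b), (s, \<not> b)] @ v)
      = word_eval G f u \<otimes> (word_eval G f [(s, b), (s, \<not> b)] \<otimes> word_eval G f v)"
    using cancel word_eval_append[OF f, of u "[(s, b), (s, \<not> b)] @ v"]
      word_eval_append[OF f, of "[(s, b), (s, \<not> b)]" v]
    by (simp del: word_eval.simps append_Cons)
  with cancel show ?case
    using word_eval_append[OF f] word_eval_closed[OF f] unfolding one by simp
next
  case (relator u v r)
  then show ?case
    using word_eval_append[OF f] word_eval_closed[OF f] R by simp
qed auto

end

lemma carrier_presented_group: "carrier (presented_group S R) = (\<lambda>w. pres_rel S R `` {w}) ` words S"
  by (auto simp: presented_group_def quotient_def)

lemma one_presented_group: "\<one>\<^bsub>presented_group S R\<^esub> = pres_rel S R `` {[]}"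
  by (simp add: presented_group_def)

lemma pres_gen_closed: "s \<in> S \<Longrightarrow> pres_gen S R s \<in> carrier (presented_group S R)"
  unfolding carrier_presented_group pres_gen_def by (rule imageI) simp

lemma pres_class_eqI: "pres_eq S R v w \<Longrightarrow> pres_rel S R `` {v} = pres_rel S R `` {w}"
  by (rule equiv_class_eq[OF equiv_pres_rel]) (simp add: pres_rel_def)

text \<open>
  Evaluation of words is constant on the congruence classes that make up the presented group, so
  it descends to them; \<open>the_elem\<close> picks the common value.
\<close>

theorem von_Dyck:
  assumes G: "group G" and f: "f \<in> S \<rightarrow> carrier G"
    and R: "\<And>r. r \<in> R \<Longrightarrow> r \<in> words S \<Longrightarrow> word_eval G f r = \<one>\<^bsub>G\<^esub>"
  obtains h where "h \<in> hom (presented_group S R) G"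
    and "\<And>s. s \<in> S \<Longrightarrow> h (pres_gen S R s) = f s"
proof
  interpret group G by fact
  let ?c = "\<lambda>w. pres_rel S R `` {w}"
  let ?h = "\<lambda>C. the_elem (word_eval G f ` C)"
  have h: "?h (?c w) = word_eval G f w" if "w \<in> words S" for w
  proof (rule the_elem_image_unique)
    show "?c w \<noteq> {}" using that by (auto simp: pres_rel_def intro: pres_eq.refl)
    show "word_eval G f v = word_eval G f w" if "v \<in> ?c w" for v
      using word_eval_respects_pres_eq[OF f R] that by (auto simp: pres_rel_def)
  qed
  show "?h \<in> hom (presented_group S R) G"
    by (rule homI)
      (auto simp: carrier_presented_group presented_group_mult h word_eval_append[OF f]
        word_eval_closed[OF f])
  show "?h (pres_gen S R s) = f s" if "s \<in> S" for s
    using h[of "[(s, True)]"] f that by (auto simp: pres_gen_def Pi_iff)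
qed

lemma inv_pres_gen:
  assumes "s \<in> S"
  shows "inv\<^bsub>presented_group S R\<^esub> pres_gen S R s = pres_rel S R `` {[(s, False)]}"
proof (rule group.inv_equality[OF group_presented_group])
  have "pres_eq S R ([] @ [(s, False), (s, \<not> False)] @ []) ([] @ [])"
    using assms by (intro pres_eq.cancel) auto
  then show "pres_rel S R `` {[(s, False)]} \<otimes>\<^bsub>presented_group S R\<^esub> pres_gen S R s
      = \<one>\<^bsub>presented_group S R\<^esub>"
    using assms by (simp add: pres_gen_def presented_group_mult one_presented_group pres_class_eqI)
qed (use assms in \<open>auto simp: pres_gen_closed\<close>, simp add: carrier_presented_group)

lemma word_eval_pres_gen:
  "w \<in> words S \<Longrightarrow> word_eval (presented_group S R) (pres_gen S R) w = pres_rel S R `` {w}"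
proof (induction w)
  case Nil
  then show ?case by (simp add: one_presented_group)
next
  case (Cons a w)
  obtain s b where "a = (s, b)" by (cases a)
  then show ?case
    using Cons
    by (cases b) (simp add: pres_gen_def presented_group_mult, simp add: inv_pres_gen presented_group_mult)
qed

lemma word_eval_relator:
  assumes "r \<in> R" "r \<in> words S"
  shows "word_eval (presented_group S R) (pres_gen S R) r = \<one>\<^bsub>presented_group S R\<^esub>"
  using pres_eq.relator[of "[]" S "[]" r R] assms
  by (simp add: word_eval_pres_gen one_presented_group pres_class_eqI)

text \<open>
  Every element of a presented group is reached from the unit by multiplying with generators and
  their inverses from the right, by induction on a representing word.
\<close>

lemma presented_group_right_induct [consumes 1, case_names one gen inv_gen]:
  assumes g: "g \<in> carrier (presented_group S R)"
    and one: "P \<one>\<^bsub>presented_group S R\<^esub>"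
    and gen: "\<And>g s. g \<in> carrier (presented_group S R) \<Longrightarrow> P g \<Longrightarrow> s \<in> S \<Longrightarrow>
      P (g \<otimes>\<^bsub>presented_group S R\<^esub> pres_gen S R s)"
    and inv: "\<And>g s. g \<in> carrier (presented_group S R) \<Longrightarrow> P g \<Longrightarrow> s \<in> S \<Longrightarrow>
      P (g \<otimes>\<^bsub>presented_group S R\<^esub> inv\<^bsub>presented_group S R\<^esub> pres_gen S R s)"
  shows "P g"
proof -
  have "P (pres_rel S R `` {w})" if "w \<in> words S" for w
    using that
  proof (induction w rule: rev_induct)
    case Nil
    then show ?case using one by (simp add: one_presented_group)
  next
    case (snoc a w)
    obtain s b where a: "a = (s, b)" by (cases a)
    have "pres_rel S R `` {w} \<in> carrier (presented_group S R)"
      using snoc.prems by (simp add: carrier_presented_group)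
    then show ?case
      using gen[of "pres_rel S R `` {w}" s] inv[of "pres_rel S R `` {w}" s] snoc a
      by (cases b) (simp add: pres_gen_def presented_group_mult, simp add: inv_pres_gen presented_group_mult)
  qed
  then show ?thesis using g by (auto simp: carrier_presented_group)
qed

section \<open>The finite cyclic group\<close>

lemma group_cyclic_presentation: "group (cyclic_presentation n)"
  by (simp add: cyclic_presentation_def group_presented_group)

lemma cyclic_gen_closed: "cyclic_gen n \<in> carrier (cyclic_presentation n)"
  by (simp add: cyclic_presentation_def cyclic_gen_def pres_gen_closed)

lemma replicate_in_words: "s \<in> S \<Longrightarrow> replicate k (s, b) \<in> words S"
  by (induction k) auto

lemma cyclic_gen_pow_order: "cyclic_gen n [^]\<^bsub>cyclic_presentation n\<^esub> n = \<one>\<^bsub>cyclic_presentation n\<^esub>"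
proof -
  have "word_eval (cyclic_presentation n) (pres_gen {()} (cyclic_relators n)) (replicate n ((), True))
      = \<one>\<^bsub>cyclic_presentation n\<^esub>"
    unfolding cyclic_presentation_def
    by (rule word_eval_relator) (auto simp: cyclic_relators_def replicate_in_words)
  then show ?thesis
    using group.word_eval_replicate[OF group_cyclic_presentation]
      cyclic_gen_closed by (metis cyclic_gen_def)
qed

lemma cyclic_presentation_elements:
  assumes "g \<in> carrier (cyclic_presentation n)"
  obtains k :: int where "g = cyclic_gen n [^]\<^bsub>cyclic_presentation n\<^esub> k"
proof -
  interpret C: group "cyclic_presentation n" by (rule group_cyclic_presentation)
  note x = cyclic_gen_closed[of n]
  have "\<exists>k::int. g = cyclic_gen n [^]\<^bsub>cyclic_presentation n\<^esub> k"
    using assms unfolding cyclic_presentation_def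
  proof (induction rule: presented_group_right_induct)
    case one
    show ?case by (rule exI[of _ 0]) (simp flip: cyclic_presentation_def)
  next
    case (gen g s)
    then obtain k :: int where "g = cyclic_gen n [^]\<^bsub>cyclic_presentation n\<^esub> k"
      by (auto simp: cyclic_presentation_def)
    then have "g \<otimes>\<^bsub>cyclic_presentation n\<^esub> cyclic_gen n
        = cyclic_gen n [^]\<^bsub>cyclic_presentation n\<^esub> (k + 1)"
      using x by (simp add: C.int_pow_mult)
    then show ?case by (auto simp: cyclic_gen_def cyclic_presentation_def)
  next
    case (inv_gen g s)
    then obtain k :: int where "g = cyclic_gen n [^]\<^bsub>cyclic_presentation n\<^esub> k"
      by (auto simp: cyclic_presentation_def)
    then have "g \<otimes>\<^bsub>cyclic_presentation n\<^esub> inv\<^bsub>cyclic_presentation n\<^esub> cyclic_gen n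
        = cyclic_gen n [^]\<^bsub>cyclic_presentation n\<^esub> (k - 1)"
      using x by (simp add: C.int_pow_diff)
    then show ?case by (auto simp: cyclic_gen_def cyclic_presentation_def)
  qed
  with that show ?thesis by blast
qed

text \<open>
  The relation $x^n = 1$ alone shows only that the order of $x$ divides $n$. This homomorphism
  shows that it is not smaller.
\<close>

lemma cyclic_to_integer_mod:
  assumes "n \<ge> 1"
  obtains h where "h \<in> hom (cyclic_presentation n) (integer_mod_group n)"
    and "\<And>k::int. h (cyclic_gen n [^]\<^bsub>cyclic_presentation n\<^esub> k) = k mod int n"
proof -
  interpret C: group "cyclic_presentation n" by (rule group_cyclic_presentation)
  interpret Z: group "integer_mod_group n" by simp
  have one: "1 mod int n \<in> carrier (integer_mod_group n)"
    using assms by (simp add: carrier_integer_mod_group)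
  obtain h where h: "h \<in> hom (cyclic_presentation n) (integer_mod_group n)"
    and gen: "\<And>s. s \<in> {()} \<Longrightarrow> h (pres_gen {()} (cyclic_relators n) s) = 1 mod int n"
    unfolding cyclic_presentation_def
  proof (rule von_Dyck)
    show "word_eval (integer_mod_group n) (\<lambda>_. 1 mod int n) r = \<one>\<^bsub>integer_mod_group n\<^esub>"
      if "r \<in> cyclic_relators n" for r
      using that one by (simp add: cyclic_relators_def Z.word_eval_replicate)
  qed (use one in auto)
  have "h (cyclic_gen n [^]\<^bsub>cyclic_presentation n\<^esub> k) = k mod int n" for k :: int
    using hom_int_pow[OF h cyclic_gen_closed C.is_group Z.is_group, of k] gen
    by (simp add: cyclic_gen_def int_pow_integer_mod_group mod_mult_right_eq)
  with h that show ?thesis by blast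
qed

lemma cyclic_gen_pow_eq_one_iff:
  assumes "n \<ge> 1"
  shows "cyclic_gen n [^]\<^bsub>cyclic_presentation n\<^esub> (k::int) = \<one>\<^bsub>cyclic_presentation n\<^esub> \<longleftrightarrow> int n dvd k"
proof
  interpret C: group "cyclic_presentation n" by (rule group_cyclic_presentation)
  obtain h where h: "h \<in> hom (cyclic_presentation n) (integer_mod_group n)"
    and pow: "\<And>k::int. h (cyclic_gen n [^]\<^bsub>cyclic_presentation n\<^esub> k) = k mod int n"
    by (rule cyclic_to_integer_mod[OF assms]) blast
  show "int n dvd k" if "cyclic_gen n [^]\<^bsub>cyclic_presentation n\<^esub> k = \<one>\<^bsub>cyclic_presentation n\<^esub>"
    using pow[of k] pow[of 0] that by (simp add: dvd_eq_mod_eq_0)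
  show "cyclic_gen n [^]\<^bsub>cyclic_presentation n\<^esub> k = \<one>\<^bsub>cyclic_presentation n\<^esub>" if "int n dvd k"
  proof -
    from that obtain q where "k = int n * q" by blast
    then have "cyclic_gen n [^]\<^bsub>cyclic_presentation n\<^esub> k
        = (cyclic_gen n [^]\<^bsub>cyclic_presentation n\<^esub> int n) [^]\<^bsub>cyclic_presentation n\<^esub> q"
      by (simp only: C.int_pow_pow[OF cyclic_gen_closed])
    then show ?thesis
      by (simp add: int_pow_int cyclic_gen_pow_order)
  qed
qed

lemma cyclic_presentation_iso:
  assumes "n \<ge> 1"
  shows "cyclic_presentation n \<cong> integer_mod_group n"
proof -
  interpret C: group "cyclic_presentation n" by (rule group_cyclic_presentation)
  interpret Z: group "integer_mod_group n" by simp
  obtain h where h: "h \<in> hom (cyclic_presentation n) (integer_mod_group n)"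
    and pow: "\<And>k::int. h (cyclic_gen n [^]\<^bsub>cyclic_presentation n\<^esub> k) = k mod int n"
    by (rule cyclic_to_integer_mod[OF assms]) blast
  interpret group_hom "cyclic_presentation n" "integer_mod_group n" h
    using h by unfold_locales
  have "h \<in> iso (cyclic_presentation n) (integer_mod_group n)"
    unfolding iso_iff
  proof (intro conjI subsetI ballI impI)
    show "k \<in> h ` carrier (cyclic_presentation n)" if "k \<in> carrier (integer_mod_group n)" for k
    proof (rule image_eqI)
      show "k = h (cyclic_gen n [^]\<^bsub>cyclic_presentation n\<^esub> k)"
        using that assms by (simp add: pow carrier_integer_mod_group)
    qed (simp add: cyclic_gen_closed)
    show "g = \<one>\<^bsub>cyclic_presentation n\<^esub>"
      if "g \<in> carrier (cyclic_presentation n)" "h g = \<one>\<^bsub>integer_mod_group n\<^esub>" for g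
      using that(1)
    proof (rule cyclic_presentation_elements)
      fix k assume "g = cyclic_gen n [^]\<^bsub>cyclic_presentation n\<^esub> (k::int)"
      with that(2) show ?thesis
        by (simp add: pow cyclic_gen_pow_eq_one_iff[OF assms] dvd_eq_mod_eq_0)
    qed
  qed
  then show ?thesis by (rule is_isoI)
qed

section \<open>Right-angled Artin groups\<close>

lemma group_raag: "group (raag \<Gamma>)"
  by (simp add: raag_def group_presented_group)

lemma raag_gen_closed: "v \<in> pverts \<Gamma> \<Longrightarrow> raag_gen \<Gamma> v \<in> carrier (raag \<Gamma>)"
  by (simp add: raag_def raag_gen_def pres_gen_closed)

lemma (in group) commutator_eq_one_iff:
  assumes "x \<in> carrier G" "y \<in> carrier G"
  shows "x \<otimes> (y \<otimes> (inv x \<otimes> inv y)) = \<one> \<longleftrightarrow> x \<otimes> y = y \<otimes> x"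
proof -
  have "x \<otimes> (y \<otimes> (inv x \<otimes> inv y)) = (x \<otimes> y) \<otimes> inv (y \<otimes> x)"
    using assms by (simp add: inv_mult_group m_assoc)
  then show ?thesis
    using assms by (metis inv_solve_right' l_one m_closed one_closed r_inv)
qed

lemma raag_universal:
  assumes G: "group G" and f: "f \<in> pverts \<Gamma> \<rightarrow> carrier G"
    and comm: "\<And>v w. (v, w) \<in> parcs \<Gamma> \<Longrightarrow> v \<in> pverts \<Gamma> \<Longrightarrow> w \<in> pverts \<Gamma> \<Longrightarrow>
      f v \<otimes>\<^bsub>G\<^esub> f w = f w \<otimes>\<^bsub>G\<^esub> f v"
  obtains h where "h \<in> hom (raag \<Gamma>) G"
    and "\<And>v. v \<in> pverts \<Gamma> \<Longrightarrow> h (raag_gen \<Gamma> v) = f v"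
proof -
  interpret group G by fact
  have "word_eval G f r = \<one>\<^bsub>G\<^esub>" if "r \<in> raag_relators \<Gamma>" "r \<in> words (pverts \<Gamma>)" for r
    using that f comm by (auto simp: raag_relators_def commutator_eq_one_iff Pi_iff)
  from von_Dyck[OF G f this] that show ?thesis
    unfolding raag_def raag_gen_def by blast
qed

lemma raag_gen_commute:
  assumes "(v, w) \<in> parcs \<Gamma>" "v \<in> pverts \<Gamma>" "w \<in> pverts \<Gamma>"
  shows "raag_gen \<Gamma> v \<otimes>\<^bsub>raag \<Gamma>\<^esub> raag_gen \<Gamma> w = raag_gen \<Gamma> w \<otimes>\<^bsub>raag \<Gamma>\<^esub> raag_gen \<Gamma> v"
proof -
  interpret group "raag \<Gamma>" by (rule group_raag)
  have "word_eval (raag \<Gamma>) (raag_gen \<Gamma>) [(v, True), (w, True), (v, False), (w, False)] = \<one>\<^bsub>raag \<Gamma>\<^esub>"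
    unfolding raag_def raag_gen_def[abs_def]
    by (rule word_eval_relator) (use assms in \<open>auto simp: raag_relators_def\<close>)
  then show ?thesis
    using assms by (simp add: commutator_eq_one_iff raag_gen_closed)
qed

text \<open>
  The generators are distinguished by the homomorphisms to the integers that send one of them to 1
  and all others to 0.
\<close>

lemma inj_on_raag_gen: "inj_on (raag_gen \<Gamma>) (pverts \<Gamma>)"
proof (rule inj_onI, rule ccontr)
  fix v w assume vw: "v \<in> pverts \<Gamma>" "w \<in> pverts \<Gamma>" "raag_gen \<Gamma> v = raag_gen \<Gamma> w" "v \<noteq> w"
  obtain h where "\<And>u. u \<in> pverts \<Gamma> \<Longrightarrow> h (raag_gen \<Gamma> u) = (if u = v then 1 else 0 :: int)"
    by (rule raag_universal[OF group_integer_group, of "\<lambda>u. if u = v then 1 else 0" \<Gamma>]) auto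
  from this[of v] this[of w] vw show False by simp
qed

lemmas raag_right_induct [consumes 1, case_names one gen inv_gen] =
  presented_group_right_induct[of _ "pverts \<Gamma>" "raag_relators \<Gamma>" for \<Gamma>,
    folded raag_def raag_gen_def]

lemma vertex_hom_exists:
  assumes "z \<in> pverts \<Gamma>" "pair_graph \<Gamma>"
  shows "\<exists>\<phi>. vertex_hom \<Gamma> z n \<phi>"
proof -
  interpret pair_graph \<Gamma> by fact
  interpret C: group "cyclic_presentation n" by (rule group_cyclic_presentation)
  obtain \<phi> where "\<phi> \<in> hom (raag \<Gamma>) (cyclic_presentation n)"
    and "\<And>v. v \<in> pverts \<Gamma> \<Longrightarrow>
      \<phi> (raag_gen \<Gamma> v) = (if v = z then cyclic_gen n else \<one>\<^bsub>cyclic_presentation n\<^esub>)"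
    by (rule raag_universal[OF C.is_group,
          of "\<lambda>v. if v = z then cyclic_gen n else \<one>\<^bsub>cyclic_presentation n\<^esub>" \<Gamma>])
      (auto simp: cyclic_gen_closed)
  with assms(1) show ?thesis unfolding vertex_hom_def by (intro exI[of _ \<phi>]) auto
qed

lemma raag_generated: "generate (raag \<Gamma>) (raag_gen \<Gamma> ` pverts \<Gamma>) = carrier (raag \<Gamma>)"
proof
  interpret group "raag \<Gamma>" by (rule group_raag)
  show "generate (raag \<Gamma>) (raag_gen \<Gamma> ` pverts \<Gamma>) \<subseteq> carrier (raag \<Gamma>)"
    by (rule generate_incl) (auto simp: raag_gen_closed)
  show "carrier (raag \<Gamma>) \<subseteq> generate (raag \<Gamma>) (raag_gen \<Gamma> ` pverts \<Gamma>)"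
  proof
    fix g assume "g \<in> carrier (raag \<Gamma>)"
    then show "g \<in> generate (raag \<Gamma>) (raag_gen \<Gamma> ` pverts \<Gamma>)"
      by (induction rule: raag_right_induct) (auto intro: generate.intros)
  qed
qed

text \<open>
  The universal property with the group of bijections of a set as its target: permutations that
  commute along the edges extend to an action. The conclusion speaks of values at points only,
  which hides the extensional functions that make up \<open>BijGroup\<close>.
\<close>

lemma raag_action:
  assumes bij: "\<And>v. v \<in> pverts \<Gamma> \<Longrightarrow> bij_betw (act v) Y Y"
    and comm: "\<And>v w p. (v, w) \<in> parcs \<Gamma> \<Longrightarrow> v \<in> pverts \<Gamma> \<Longrightarrow> w \<in> pverts \<Gamma> \<Longrightarrow> p \<in> Y \<Longrightarrow>
      act v (act w p) = act w (act v p)"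
  obtains \<alpha> where "\<And>g h p. g \<in> carrier (raag \<Gamma>) \<Longrightarrow> h \<in> carrier (raag \<Gamma>) \<Longrightarrow> p \<in> Y \<Longrightarrow>
      \<alpha> (g \<otimes>\<^bsub>raag \<Gamma>\<^esub> h) p = \<alpha> g (\<alpha> h p)"
    and "\<And>p. p \<in> Y \<Longrightarrow> \<alpha> \<one>\<^bsub>raag \<Gamma>\<^esub> p = p"
    and "\<And>v p. v \<in> pverts \<Gamma> \<Longrightarrow> p \<in> Y \<Longrightarrow> \<alpha> (raag_gen \<Gamma> v) p = act v p"
proof -
  have Bij: "restrict (act v) Y \<in> Bij Y" if "v \<in> pverts \<Gamma>" for v
    using bij[OF that] by (simp add: Bij_def cong: bij_betw_cong)
  have closed: "act v p \<in> Y" if "v \<in> pverts \<Gamma>" "p \<in> Y" for v p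
    using bij_betwE[OF bij] that by blast
  obtain \<alpha> where hom: "\<alpha> \<in> hom (raag \<Gamma>) (BijGroup Y)"
    and gen: "\<And>v. v \<in> pverts \<Gamma> \<Longrightarrow> \<alpha> (raag_gen \<Gamma> v) = restrict (act v) Y"
  proof (rule raag_universal[OF group_BijGroup, of "\<lambda>v. restrict (act v) Y" \<Gamma> Y])
    show "restrict (act v) Y \<otimes>\<^bsub>BijGroup Y\<^esub> restrict (act w) Y
        = restrict (act w) Y \<otimes>\<^bsub>BijGroup Y\<^esub> restrict (act v) Y"
      if "(v, w) \<in> parcs \<Gamma>" "v \<in> pverts \<Gamma>" "w \<in> pverts \<Gamma>" for v w
      using that Bij comm closed by (auto simp: BijGroup_def compose_def fun_eq_iff)
  qed (use Bij in \<open>auto simp: BijGroup_def\<close>)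
  have carr: "\<alpha> g \<in> Bij Y" if "g \<in> carrier (raag \<Gamma>)" for g
    using hom_in_carrier[OF hom that] by (simp add: BijGroup_def)
  show ?thesis
  proof (rule that[of \<alpha>])
    show "\<alpha> (g \<otimes>\<^bsub>raag \<Gamma>\<^esub> h) p = \<alpha> g (\<alpha> h p)"
      if "g \<in> carrier (raag \<Gamma>)" "h \<in> carrier (raag \<Gamma>)" "p \<in> Y" for g h p
      using that hom_mult[OF hom] carr by (simp add: BijGroup_def compose_def)
    show "\<alpha> \<one>\<^bsub>raag \<Gamma>\<^esub> p = p" if "p \<in> Y" for p
      using that hom_one[OF hom group_raag group_BijGroup] by (simp add: BijGroup_def)
    show "\<alpha> (raag_gen \<Gamma> v) p = act v p" if "v \<in> pverts \<Gamma>" "p \<in> Y" for v p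
      using that gen by simp
  qed
qed

section \<open>The gluing homomorphism\<close>

context group
begin

lemma commute_mult:
  assumes "x \<in> carrier G" "y \<in> carrier G" "w \<in> carrier G"
    and "x \<otimes> y = y \<otimes> x" "x \<otimes> w = w \<otimes> x"
  shows "x \<otimes> (y \<otimes> w) = (y \<otimes> w) \<otimes> x"
  using assms by (metis m_assoc)

lemma commute_inv:
  assumes "x \<in> carrier G" "y \<in> carrier G" "x \<otimes> y = y \<otimes> x"
  shows "x \<otimes> inv y = inv y \<otimes> x"
  using assms by (metis inv_closed inv_solve_left inv_solve_right m_assoc m_closed)

lemma commute_int_pow:
  assumes "x \<in> carrier G" "y \<in> carrier G" "x \<otimes> y = y \<otimes> x"
  shows "x \<otimes> y [^] (k::int) = y [^] k \<otimes> x"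
proof -
  have "x \<otimes> y [^] m = y [^] m \<otimes> x" for m :: nat
    using assms group_commutes_pow[of y x m] by simp
  then show ?thesis
    using assms by (cases k rule: int_cases2) (simp_all add: int_pow_int int_pow_neg_int commute_inv)
qed

lemma conj_mult:
  assumes "c \<in> carrier G" "x \<in> carrier G" "y \<in> carrier G"
  shows "(c \<otimes> x \<otimes> inv c) \<otimes> (c \<otimes> y \<otimes> inv c) = c \<otimes> (x \<otimes> y) \<otimes> inv c"
proof -
  have "inv c \<otimes> (c \<otimes> (y \<otimes> inv c)) = y \<otimes> inv c"
    using assms by (simp flip: m_assoc)
  then show ?thesis using assms by (simp add: m_assoc)
qed

end

locale star_gluing = pair_graph \<Gamma> for \<Gamma> :: "'a pair_pre_digraph" +
  fixes z :: 'a and n :: nat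
  assumes z: "z \<in> pverts \<Gamma>" and n: "n \<ge> 1"
begin

abbreviation A where "A \<equiv> raag \<Gamma>"
abbreviation gen where "gen \<equiv> raag_gen \<Gamma>"
abbreviation \<Gamma>' where "\<Gamma>' \<equiv> glue_copies \<Gamma> z n"
abbreviation B where "B \<equiv> raag \<Gamma>'"
abbreviation gen' where "gen' \<equiv> raag_gen \<Gamma>'"

sublocale A: group A by (rule group_raag)
sublocale B: group B by (rule group_raag)

lemma arc_sym: "(v, w) \<in> parcs \<Gamma> \<Longrightarrow> (w, v) \<in> parcs \<Gamma>"
  using pair_sym_arcs by (auto simp: symmetric_def dest: symD)

lemma link_pverts: "v \<in> link \<Gamma> z \<Longrightarrow> v \<in> pverts \<Gamma>"
  by (auto simp: link_def dest: wellformed')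

lemma z_notin_link: "z \<notin> link \<Gamma> z"
  by (auto simp: link_def dest: no_loops')

lemma link_iff: "(z, v) \<in> parcs \<Gamma> \<longleftrightarrow> v \<in> link \<Gamma> z" "(v, z) \<in> parcs \<Gamma> \<longleftrightarrow> v \<in> link \<Gamma> z"
  by (auto simp: link_def arc_sym)

lemma base_pverts: "Base v \<in> pverts \<Gamma>' \<longleftrightarrow> v \<in> star \<Gamma> z"
  by (auto simp: glue_copies_def)

lemma copy_pverts: "Copy k u \<in> pverts \<Gamma>' \<longleftrightarrow> k < n \<and> u \<in> pverts \<Gamma> - star \<Gamma> z"
  by (auto simp: glue_copies_def)

fun kernel_gen :: "'a glued_vertex \<Rightarrow> 'a word set" where
  "kernel_gen (Base v) = (if v = z then gen z [^]\<^bsub>A\<^esub> n else gen v)"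
| "kernel_gen (Copy k u) = conj_gen \<Gamma> z k u"

lemma kernel_gens_eq: "kernel_gens \<Gamma> z n = kernel_gen ` pverts \<Gamma>'"
proof -
  have "pverts \<Gamma>' = {Base z} \<union> Base ` link \<Gamma> z \<union> {Copy k u | k u. k < n \<and> u \<in> pverts \<Gamma> - star \<Gamma> z}"
    by (auto simp: glue_copies_def star_def)
  moreover have "kernel_gen ` Base ` link \<Gamma> z = gen ` link \<Gamma> z"
    using z_notin_link by (auto simp: image_image intro!: image_cong)
  moreover have "kernel_gen ` {Copy k u | k u. k < n \<and> u \<in> pverts \<Gamma> - star \<Gamma> z}
      = {conj_gen \<Gamma> z k u | k u. k < n \<and> u \<in> pverts \<Gamma> - star \<Gamma> z}"
    by (force simp: image_iff)
  ultimately show ?thesis by (simp add: kernel_gens_def image_Un)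
qed

lemma kernel_gen_closed: "v \<in> pverts \<Gamma>' \<Longrightarrow> kernel_gen v \<in> carrier A"
  using z by (cases v)
    (auto simp: base_pverts copy_pverts star_def conj_gen_def raag_gen_closed link_pverts)

lemma gen_commute: "(v, w) \<in> parcs \<Gamma> \<Longrightarrow> gen v \<otimes>\<^bsub>A\<^esub> gen w = gen w \<otimes>\<^bsub>A\<^esub> gen v"
  by (rule raag_gen_commute) (auto dest: wellformed')

lemma link_gen_commute_pow:
  assumes "v \<in> link \<Gamma> z"
  shows "gen v \<otimes>\<^bsub>A\<^esub> gen z [^]\<^bsub>A\<^esub> (k::int) = gen z [^]\<^bsub>A\<^esub> k \<otimes>\<^bsub>A\<^esub> gen v"
  using assms z
  by (intro A.commute_int_pow gen_commute) (auto simp: raag_gen_closed link_pverts link_iff)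

lemma link_gen_commute_conj_gen:
  assumes "v \<in> link \<Gamma> z" "(v, u) \<in> parcs \<Gamma>"
  shows "gen v \<otimes>\<^bsub>A\<^esub> conj_gen \<Gamma> z k u = conj_gen \<Gamma> z k u \<otimes>\<^bsub>A\<^esub> gen v"
proof -
  have "u \<in> pverts \<Gamma>" "v \<in> pverts \<Gamma>" using assms(2) by (auto dest: wellformed')
  moreover have "gen v \<otimes>\<^bsub>A\<^esub> gen z [^]\<^bsub>A\<^esub> k = gen z [^]\<^bsub>A\<^esub> k \<otimes>\<^bsub>A\<^esub> gen v"
    using link_gen_commute_pow[OF assms(1), of "int k"] by (simp add: int_pow_int)
  ultimately show ?thesis
    using z gen_commute[OF assms(2)] unfolding conj_gen_def
    by (intro A.commute_mult A.commute_inv) (auto simp: raag_gen_closed)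
qed

lemma conj_gen_commute:
  assumes "(u, w) \<in> parcs \<Gamma>"
  shows "conj_gen \<Gamma> z k u \<otimes>\<^bsub>A\<^esub> conj_gen \<Gamma> z k w = conj_gen \<Gamma> z k w \<otimes>\<^bsub>A\<^esub> conj_gen \<Gamma> z k u"
proof -
  have "u \<in> pverts \<Gamma>" "w \<in> pverts \<Gamma>" using assms by (auto dest: wellformed')
  then show ?thesis
    unfolding conj_gen_def using z by (simp add: A.conj_mult raag_gen_closed gen_commute[OF assms])
qed

lemma kernel_gen_commute:
  assumes "(v, w) \<in> parcs \<Gamma>'"
  shows "kernel_gen v \<otimes>\<^bsub>A\<^esub> kernel_gen w = kernel_gen w \<otimes>\<^bsub>A\<^esub> kernel_gen v"
proof -
  have base_comm: "kernel_gen (Base v) \<otimes>\<^bsub>A\<^esub> kernel_gen (Base w)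
      = kernel_gen (Base w) \<otimes>\<^bsub>A\<^esub> kernel_gen (Base v)" if "(v, w) \<in> parcs \<Gamma>" for v w
    using that link_gen_commute_pow[of v "int n"] link_gen_commute_pow[of w "int n"] gen_commute[OF that]
    by (cases "v = z"; cases "w = z") (simp_all add: int_pow_int link_iff)
  have copy_comm: "kernel_gen (Base v) \<otimes>\<^bsub>A\<^esub> kernel_gen (Copy k u)
      = kernel_gen (Copy k u) \<otimes>\<^bsub>A\<^esub> kernel_gen (Base v)"
    if "v \<in> link \<Gamma> z" "(v, u) \<in> parcs \<Gamma>" for k u v
    using that z_notin_link by (auto simp: link_gen_commute_conj_gen)
  from assms consider
    (base) x y where "v = Base x" "w = Base y" "(x, y) \<in> parcs \<Gamma>"
    | (copy_link) k u x where "v = Copy k u" "w = Base x" "x \<in> link \<Gamma> z" "(x, u) \<in> parcs \<Gamma>"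
    | (link_copy) k u x where "v = Base x" "w = Copy k u" "x \<in> link \<Gamma> z" "(x, u) \<in> parcs \<Gamma>"
    | (copies) k u x where "v = Copy k u" "w = Copy k x" "(u, x) \<in> parcs \<Gamma>"
    by (auto simp: glue_copies_def arc_sym)
  then show ?thesis
  proof cases
    case base
    then show ?thesis using base_comm by blast
  next
    case copy_link
    then show ?thesis using copy_comm by metis
  next
    case link_copy
    then show ?thesis using copy_comm by metis
  next
    case copies
    then show ?thesis using conj_gen_commute by simp
  qed
qed

lemma gluing_hom_exists:
  obtains \<psi> where "\<psi> \<in> hom B A" and "\<And>v. v \<in> pverts \<Gamma>' \<Longrightarrow> \<psi> (gen' v) = kernel_gen v"
  by (rule raag_universal[OF A.is_group, of kernel_gen \<Gamma>'])
    (use kernel_gen_commute in \<open>simp_all add: kernel_gen_closed\<close>)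

section \<open>Injectivity: the coset action\<close>

text \<open>
  For $v \noteq z$, the vertex of $\Gamma'$ that represents $z^i v z^{-i}$: for $v \in lk(z)$ this
  conjugate does not depend on $i$.
\<close>

definition lift_vertex :: "nat \<Rightarrow> 'a \<Rightarrow> 'a glued_vertex" where
  "lift_vertex i v = (if v \<in> link \<Gamma> z then Base v else Copy i v)"

text \<open>
  Left multiplication by a generator on $A$, in the coordinates $(i, b)$ of $z^{-i} b$. Negative
  powers of $z$ are used as coset representatives because $v z^{-i} b = z^{-i} (z^i v z^{-i}) b$
  then involves exactly the conjugates by which $\Gamma'$ is labelled. For $i = 0$ the equation
  $z b = z^{-(n-1)} z^n b$ brings in the generator \<open>Base z\<close>.
\<close>

definition coset_act :: "'a \<Rightarrow> nat \<times> 'a glued_vertex word set \<Rightarrow> nat \<times> 'a glued_vertex word set" where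
  "coset_act v = (\<lambda>(i, b).
    if v = z then if i = 0 then (n - 1, gen' (Base z) \<otimes>\<^bsub>B\<^esub> b) else (i - 1, b)
    else (i, gen' (lift_vertex i v) \<otimes>\<^bsub>B\<^esub> b))"

lemma gen'_Base_z_closed: "gen' (Base z) \<in> carrier B"
  by (rule raag_gen_closed) (simp add: base_pverts star_def)

lemma gen'_lift_closed:
  "v \<in> pverts \<Gamma> \<Longrightarrow> v \<noteq> z \<Longrightarrow> i < n \<Longrightarrow> gen' (lift_vertex i v) \<in> carrier B"
  by (rule raag_gen_closed) (auto simp: lift_vertex_def base_pverts copy_pverts star_def)

lemma gen'_commute:
  assumes "(v, w) \<in> parcs \<Gamma>'"
  shows "gen' v \<otimes>\<^bsub>B\<^esub> gen' w = gen' w \<otimes>\<^bsub>B\<^esub> gen' v"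
proof -
  interpret G': pair_graph \<Gamma>' using pair_graph_axioms z by (rule pair_graph_glue_copies)
  show ?thesis using assms by (intro raag_gen_commute) (auto dest: G'.wellformed')
qed

lemma lift_vertex_arc:
  assumes "(v, w) \<in> parcs \<Gamma>" "v \<noteq> z" "w \<noteq> z" "i < n"
  shows "(lift_vertex i v, lift_vertex i w) \<in> parcs \<Gamma>'"
  using assms by (auto simp: lift_vertex_def glue_copies_def star_def)

lemma bij_coset_act:
  assumes v: "v \<in> pverts \<Gamma>"
  shows "bij_betw (coset_act v) ({..<n} \<times> carrier B) ({..<n} \<times> carrier B)"
proof (cases "v = z")
  case True
  let ?inv = "\<lambda>(i, b). if i = n - 1 then (0, inv\<^bsub>B\<^esub> gen' (Base z) \<otimes>\<^bsub>B\<^esub> b) else (i + 1, b)"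
  show ?thesis
    by (rule bij_betw_byWitness[where f' = ?inv])
      (use n True gen'_Base_z_closed in
        \<open>auto simp: coset_act_def B.m_assoc[symmetric] split: if_splits\<close>)
next
  case False
  let ?inv = "\<lambda>(i, b). (i, inv\<^bsub>B\<^esub> gen' (lift_vertex i v) \<otimes>\<^bsub>B\<^esub> b)"
  show ?thesis
    by (rule bij_betw_byWitness[where f' = ?inv])
      (use v False gen'_lift_closed in \<open>auto simp: coset_act_def B.m_assoc[symmetric]\<close>)
qed

text \<open>
  For an edge at $z$ this uses that $z$ and its neighbours remain adjacent in $\Gamma'$; any other
  edge acts on level $i$ through its lift to the $i$-th copy.
\<close>

lemma coset_act_commute:
  assumes arc: "(v, w) \<in> parcs \<Gamma>" and p: "p \<in> {..<n} \<times> carrier B"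
  shows "coset_act v (coset_act w p) = coset_act w (coset_act v p)"
proof -
  obtain i b where ib: "p = (i, b)" "i < n" "b \<in> carrier B" using p by auto
  have vw: "v \<in> pverts \<Gamma>" "w \<in> pverts \<Gamma>" "v \<noteq> w"
    using arc by (auto dest: wellformed' no_loops')
  have z_link: "coset_act z (coset_act w p) = coset_act w (coset_act z p)"
    if w: "w \<in> link \<Gamma> z" for w
  proof -
    have "(Base z, Base w) \<in> parcs \<Gamma>'"
      using w by (auto simp: glue_copies_def star_def link_def)
    from gen'_commute[OF this]
    have "gen' (Base z) \<otimes>\<^bsub>B\<^esub> (gen' (Base w) \<otimes>\<^bsub>B\<^esub> b) = gen' (Base w) \<otimes>\<^bsub>B\<^esub> (gen' (Base z) \<otimes>\<^bsub>B\<^esub> b)"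
      using w ib by (simp add: B.m_assoc[symmetric] raag_gen_closed base_pverts star_def)
    then show ?thesis
      using w z_notin_link ib by (auto simp: coset_act_def lift_vertex_def)
  qed
  show ?thesis
  proof (cases "v = z \<or> w = z")
    case True
    then show ?thesis using z_link arc by (auto simp: link_iff)
  next
    case False
    have "gen' (lift_vertex i v) \<otimes>\<^bsub>B\<^esub> (gen' (lift_vertex i w) \<otimes>\<^bsub>B\<^esub> b)
        = gen' (lift_vertex i w) \<otimes>\<^bsub>B\<^esub> (gen' (lift_vertex i v) \<otimes>\<^bsub>B\<^esub> b)"
      using False vw ib gen'_commute[OF lift_vertex_arc[OF arc, of i]]
      by (simp add: B.m_assoc[symmetric] gen'_lift_closed)
    then show ?thesis using False ib by (simp add: coset_act_def)
  qed
qed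

text \<open>
  An element $g$ of $B$ can be recovered from $\psi(g)$: it is the second component of
  $\psi(g) \cdot (0, 1)$ under the coset action.
\<close>

lemma gluing_hom_inj:
  assumes \<psi>: "\<psi> \<in> hom B A" and \<psi>_gen: "\<And>v. v \<in> pverts \<Gamma>' \<Longrightarrow> \<psi> (gen' v) = kernel_gen v"
  shows "inj_on \<psi> (carrier B)"
proof -
  let ?X = "{..<n} \<times> carrier B"
  note gz = raag_gen_closed[OF z]
  interpret \<psi>: group_hom B A \<psi> using \<psi> by unfold_locales
  obtain \<alpha> where mult: "\<And>g h p. g \<in> carrier A \<Longrightarrow> h \<in> carrier A \<Longrightarrow> p \<in> ?X \<Longrightarrow>
      \<alpha> (g \<otimes>\<^bsub>A\<^esub> h) p = \<alpha> g (\<alpha> h p)"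
    and \<alpha>_one: "\<And>p. p \<in> ?X \<Longrightarrow> \<alpha> \<one>\<^bsub>A\<^esub> p = p"
    and act: "\<And>v p. v \<in> pverts \<Gamma> \<Longrightarrow> p \<in> ?X \<Longrightarrow> \<alpha> (gen v) p = coset_act v p"
    by (rule raag_action[of \<Gamma> coset_act ?X]) (use bij_coset_act coset_act_commute in blast)+
  have inv: "\<alpha> (inv\<^bsub>A\<^esub> g) q = p" if "g \<in> carrier A" "p \<in> ?X" "\<alpha> g p = q" for g p q
    using mult[of "inv\<^bsub>A\<^esub> g" g p] \<alpha>_one[of p] that by simp
  \<comment> \<open>As long as the level stays non-negative, a power of \<open>z\<close> only lowers it; the wrap-around
    happens only in the case of \<open>z ^ n\<close> below.\<close>
  have pow: "\<alpha> (gen z [^]\<^bsub>A\<^esub> k) (i, b) = (i - k, b)"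
    if "k \<le> i" "i < n" "b \<in> carrier B" for k i b
    using that
  proof (induction k arbitrary: i)
    case 0
    then show ?case using \<alpha>_one by simp
  next
    case (Suc k)
    then have "\<alpha> (gen z [^]\<^bsub>A\<^esub> Suc k) (i, b) = \<alpha> (gen z [^]\<^bsub>A\<^esub> k) (i - 1, b)"
      using mult[of "gen z [^]\<^bsub>A\<^esub> k" "gen z" "(i, b)"] act[OF z, of "(i, b)"] gz
      by (simp add: coset_act_def)
    also have "\<dots> = (i - Suc k, b)" using Suc.IH[of "i - 1"] Suc.prems by simp
    finally show ?case .
  qed
  have kernel_gen: "\<alpha> (kernel_gen v) (0, b) = (0, gen' v \<otimes>\<^bsub>B\<^esub> b)"
    if v: "v \<in> pverts \<Gamma>'" and b: "b \<in> carrier B" for v b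
  proof (cases v)
    case (Base w)
    show ?thesis
    proof (cases "w = z")
      case True
      define m where "m = n - 1"
      have m: "m < n" and pow_n: "gen z [^]\<^bsub>A\<^esub> n = gen z [^]\<^bsub>A\<^esub> m \<otimes>\<^bsub>A\<^esub> gen z"
        using n A.nat_pow_Suc[of "gen z" m] by (auto simp: m_def)
      have "\<alpha> (gen z [^]\<^bsub>A\<^esub> n) (0, b) = \<alpha> (gen z [^]\<^bsub>A\<^esub> m) (m, gen' (Base z) \<otimes>\<^bsub>B\<^esub> b)"
        using mult[of "gen z [^]\<^bsub>A\<^esub> m" "gen z" "(0, b)"] act[OF z, of "(0, b)"] gz b n
        by (simp add: pow_n coset_act_def m_def)
      also have "\<dots> = (0, gen' (Base z) \<otimes>\<^bsub>B\<^esub> b)"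
        using pow[of m m "gen' (Base z) \<otimes>\<^bsub>B\<^esub> b"] b gen'_Base_z_closed m by simp
      finally show ?thesis using Base True by simp
    next
      case False
      then have "w \<in> link \<Gamma> z" using v Base by (simp add: base_pverts star_def)
      then show ?thesis
        using Base False b n act[of w "(0, b)"]
        by (simp add: coset_act_def lift_vertex_def link_pverts)
    qed
  next
    case (Copy k u)
    then have k: "k < n" and u: "u \<in> pverts \<Gamma>" "u \<notin> star \<Gamma> z"
      using v by (auto simp: copy_pverts)
    then have lift: "lift_vertex k u = v" "u \<noteq> z" using Copy by (auto simp: lift_vertex_def star_def)
    \<comment> \<open>The path of \<open>(0, b)\<close> is \<open>(k, b)\<close>, \<open>(k, v b)\<close>, \<open>(0, v b)\<close>: climb to level \<open>k\<close>, where
      \<open>u\<close> acts as its \<open>k\<close>-th copy, and descend.\<close>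
    let ?c = "gen z [^]\<^bsub>A\<^esub> k" and ?b' = "gen' v \<otimes>\<^bsub>B\<^esub> b"
    have b': "?b' \<in> carrier B" using v b by (simp add: raag_gen_closed)
    have "\<alpha> (inv\<^bsub>A\<^esub> ?c) (0, b) = (k, b)"
      using inv[of ?c "(k, b)"] pow[of k k b] gz k b by simp
    moreover have "\<alpha> (gen u) (k, b) = (k, ?b')"
      using act[OF u(1), of "(k, b)"] lift k b by (simp add: coset_act_def)
    moreover have "\<alpha> ?c (k, ?b') = (0, ?b')"
      using pow[of k k ?b'] k b' by simp
    ultimately show ?thesis
      using Copy gz u k b n mult[of "?c \<otimes>\<^bsub>A\<^esub> gen u" "inv\<^bsub>A\<^esub> ?c" "(0, b)"] mult[of ?c "gen u" "(k, b)"]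
      by (simp add: conj_gen_def raag_gen_closed)
  qed
  have main: "\<forall>b\<in>carrier B. \<alpha> (\<psi> g) (0, b) = (0, g \<otimes>\<^bsub>B\<^esub> b)" if "g \<in> carrier B" for g
    using that
  proof (induction rule: raag_right_induct)
    case one
    then show ?case using \<alpha>_one n by simp
  next
    case (gen g v)
    show ?case
    proof
      fix b assume b: "b \<in> carrier B"
      have v: "gen' v \<in> carrier B" by (rule raag_gen_closed) fact
      have "\<alpha> (\<psi> (g \<otimes>\<^bsub>B\<^esub> gen' v)) (0, b) = \<alpha> (\<psi> g) (0, gen' v \<otimes>\<^bsub>B\<^esub> b)"
        using gen v b n mult[of "\<psi> g" "\<psi> (gen' v)" "(0, b)"] kernel_gen[of v b]
        by (simp add: \<psi>_gen kernel_gen_closed)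
      also have "\<dots> = (0, g \<otimes>\<^bsub>B\<^esub> gen' v \<otimes>\<^bsub>B\<^esub> b)"
        using gen v b by (simp add: B.m_assoc)
      finally show "\<alpha> (\<psi> (g \<otimes>\<^bsub>B\<^esub> gen' v)) (0, b) = (0, g \<otimes>\<^bsub>B\<^esub> gen' v \<otimes>\<^bsub>B\<^esub> b)" .
    qed
  next
    case (inv_gen g v)
    show ?case
    proof
      fix b assume b: "b \<in> carrier B"
      have v: "gen' v \<in> carrier B" by (rule raag_gen_closed) fact
      let ?b' = "inv\<^bsub>B\<^esub> gen' v \<otimes>\<^bsub>B\<^esub> b"
      have "gen' v \<otimes>\<^bsub>B\<^esub> ?b' = b" using v b by (simp flip: B.m_assoc)
      then have "\<alpha> (\<psi> (gen' v)) (0, ?b') = (0, b)"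
        using kernel_gen[of v ?b'] inv_gen v b by (simp add: \<psi>_gen)
      then have "\<alpha> (inv\<^bsub>A\<^esub> \<psi> (gen' v)) (0, b) = (0, ?b')"
        using v b n by (intro inv) auto
      then have "\<alpha> (\<psi> (g \<otimes>\<^bsub>B\<^esub> inv\<^bsub>B\<^esub> gen' v)) (0, b) = \<alpha> (\<psi> g) (0, ?b')"
        using inv_gen v b n mult[of "\<psi> g" "inv\<^bsub>A\<^esub> \<psi> (gen' v)" "(0, b)"] by simp
      also have "\<dots> = (0, g \<otimes>\<^bsub>B\<^esub> inv\<^bsub>B\<^esub> gen' v \<otimes>\<^bsub>B\<^esub> b)"
        using inv_gen v b by (simp add: B.m_assoc)
      finally show "\<alpha> (\<psi> (g \<otimes>\<^bsub>B\<^esub> inv\<^bsub>B\<^esub> gen' v)) (0, b) = (0, g \<otimes>\<^bsub>B\<^esub> inv\<^bsub>B\<^esub> gen' v \<otimes>\<^bsub>B\<^esub> b)" .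
    qed
  qed
  show ?thesis
    unfolding \<psi>.inj_on_one_iff
  proof (intro ballI impI allI)
    fix g assume "g \<in> carrier B" "\<psi> g = \<one>\<^bsub>A\<^esub>"
    then show "g = \<one>\<^bsub>B\<^esub>"
      using main[of g] \<alpha>_one[of "(0, \<one>\<^bsub>B\<^esub>)"] n by auto
  qed
qed

section \<open>The kernel\<close>

lemma generate_kernel_gens_eq_image:
  assumes \<psi>: "\<psi> \<in> hom B A" and \<psi>_gen: "\<And>v. v \<in> pverts \<Gamma>' \<Longrightarrow> \<psi> (gen' v) = kernel_gen v"
  shows "generate A (kernel_gens \<Gamma> z n) = \<psi> ` carrier B"
proof -
  interpret \<psi>: group_hom B A \<psi> using \<psi> by unfold_locales
  have "kernel_gens \<Gamma> z n = \<psi> ` gen' ` pverts \<Gamma>'"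
    by (simp add: kernel_gens_eq image_image \<psi>_gen)
  then show ?thesis
    using \<psi>.generate_img[of "gen' ` pverts \<Gamma>'"] raag_generated[of \<Gamma>']
    by (simp add: raag_gen_closed image_subset_iff)
qed

lemma kernel_gens_closed: "kernel_gens \<Gamma> z n \<subseteq> carrier A"
  by (auto simp: kernel_gens_eq kernel_gen_closed)

lemma subgroup_generate_kernel_gens: "subgroup (generate A (kernel_gens \<Gamma> z n)) A"
  by (rule A.generate_is_subgroup[OF kernel_gens_closed])

text \<open>
  The generating set contains the conjugates by $z^k$ for $0 \le k < n$ only; conjugating these by
  powers of $z^n$, which belongs to the set as well, gives those for all integers $k$.
\<close>

lemma conj_in_generate:
  assumes v: "v \<in> pverts \<Gamma> - {z}"
  shows "gen z [^]\<^bsub>A\<^esub> (k::int) \<otimes>\<^bsub>A\<^esub> gen v \<otimes>\<^bsub>A\<^esub> inv\<^bsub>A\<^esub> (gen z [^]\<^bsub>A\<^esub> k) \<in> generate A (kernel_gens \<Gamma> z n)"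
proof -
  let ?H = "generate A (kernel_gens \<Gamma> z n)"
  interpret H: subgroup ?H A by (rule subgroup_generate_kernel_gens)
  note gz = raag_gen_closed[OF z]
  have gv: "gen v \<in> carrier A" using v by (simp add: raag_gen_closed)
  show ?thesis
  proof (cases "v \<in> link \<Gamma> z")
    case True
    then have "gen z [^]\<^bsub>A\<^esub> k \<otimes>\<^bsub>A\<^esub> gen v \<otimes>\<^bsub>A\<^esub> inv\<^bsub>A\<^esub> (gen z [^]\<^bsub>A\<^esub> k) = gen v"
      using gz gv by (simp add: link_gen_commute_pow[symmetric] A.m_assoc)
    moreover have "gen v \<in> ?H"
      using True by (auto simp: kernel_gens_def intro: generate.incl)
    ultimately show ?thesis by simp
  next
    case False
    define q r where "q = k div int n" and "r = nat (k mod int n)"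
    have r: "r < n" "k = int n * q + int r"
      using n by (auto simp: q_def r_def nat_less_iff)
    let ?t = "(gen z [^]\<^bsub>A\<^esub> n) [^]\<^bsub>A\<^esub> q"
    have t: "?t \<in> ?H"
      by (rule A.subgroup_int_pow_closed[OF subgroup_generate_kernel_gens])
        (auto simp: kernel_gens_def intro: generate.incl)
    have c: "conj_gen \<Gamma> z r v \<in> ?H"
      using r False v by (auto simp: kernel_gens_def star_def intro!: generate.incl)
    have "gen z [^]\<^bsub>A\<^esub> k = ?t \<otimes>\<^bsub>A\<^esub> gen z [^]\<^bsub>A\<^esub> r"
      using gz by (simp add: r(2) A.int_pow_mult A.int_pow_pow[symmetric] int_pow_int)
    then have "gen z [^]\<^bsub>A\<^esub> k \<otimes>\<^bsub>A\<^esub> gen v \<otimes>\<^bsub>A\<^esub> inv\<^bsub>A\<^esub> (gen z [^]\<^bsub>A\<^esub> k)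
        = ?t \<otimes>\<^bsub>A\<^esub> conj_gen \<Gamma> z r v \<otimes>\<^bsub>A\<^esub> inv\<^bsub>A\<^esub> ?t"
      using gz gv by (simp add: conj_gen_def A.m_assoc A.inv_mult_group)
    then show ?thesis using t c by simp
  qed
qed

text \<open>
  Appending $v \noteq z$ to $h z^k$ gives $h (z^k v z^{-k}) z^k$, and appending $z$ only changes $k$.
\<close>

lemma generate_times_powers:
  assumes "g \<in> carrier A"
  shows "\<exists>h (k::int). h \<in> generate A (kernel_gens \<Gamma> z n) \<and> g = h \<otimes>\<^bsub>A\<^esub> gen z [^]\<^bsub>A\<^esub> k"
proof -
  let ?H = "generate A (kernel_gens \<Gamma> z n)"
  interpret H: subgroup ?H A by (rule subgroup_generate_kernel_gens)
  note gz = raag_gen_closed[OF z]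
  have step: "\<exists>h' (k'::int). h' \<in> ?H \<and> h \<otimes>\<^bsub>A\<^esub> gen z [^]\<^bsub>A\<^esub> k \<otimes>\<^bsub>A\<^esub> x = h' \<otimes>\<^bsub>A\<^esub> gen z [^]\<^bsub>A\<^esub> k'"
    if h: "h \<in> ?H" and x: "x \<in> carrier A"
      and c: "gen z [^]\<^bsub>A\<^esub> k \<otimes>\<^bsub>A\<^esub> x \<otimes>\<^bsub>A\<^esub> inv\<^bsub>A\<^esub> (gen z [^]\<^bsub>A\<^esub> k) \<in> ?H" for h x and k :: int
  proof (intro exI conjI)
    show "h \<otimes>\<^bsub>A\<^esub> (gen z [^]\<^bsub>A\<^esub> k \<otimes>\<^bsub>A\<^esub> x \<otimes>\<^bsub>A\<^esub> inv\<^bsub>A\<^esub> (gen z [^]\<^bsub>A\<^esub> k)) \<in> ?H" using h c by simp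
    show "h \<otimes>\<^bsub>A\<^esub> gen z [^]\<^bsub>A\<^esub> k \<otimes>\<^bsub>A\<^esub> x
        = h \<otimes>\<^bsub>A\<^esub> (gen z [^]\<^bsub>A\<^esub> k \<otimes>\<^bsub>A\<^esub> x \<otimes>\<^bsub>A\<^esub> inv\<^bsub>A\<^esub> (gen z [^]\<^bsub>A\<^esub> k)) \<otimes>\<^bsub>A\<^esub> gen z [^]\<^bsub>A\<^esub> k"
      using h x gz by (simp add: A.m_assoc)
  qed
  from assms show ?thesis
  proof (induction rule: raag_right_induct)
    case one
    show ?case by (intro exI[of _ "\<one>\<^bsub>A\<^esub>"] exI[of _ 0]) simp
  next
    case (gen g v)
    then obtain h and k :: int where h: "h \<in> ?H" "g = h \<otimes>\<^bsub>A\<^esub> raag_gen \<Gamma> z [^]\<^bsub>A\<^esub> k" by blast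
    show ?case
    proof (cases "v = z")
      case True
      show ?thesis
        by (intro exI[of _ h] exI[of _ "k + 1"]) (use True h gz in \<open>simp add: A.int_pow_mult A.m_assoc\<close>)
    next
      case False
      then show ?thesis
        using gen h conj_in_generate[of v k] unfolding h(2) by (intro step) (auto simp: raag_gen_closed)
    qed
  next
    case (inv_gen g v)
    then obtain h and k :: int where h: "h \<in> ?H" "g = h \<otimes>\<^bsub>A\<^esub> gen z [^]\<^bsub>A\<^esub> k" by blast
    show ?case
    proof (cases "v = z")
      case True
      show ?thesis
        by (intro exI[of _ h] exI[of _ "k - 1"]) (use True h gz in \<open>simp add: A.int_pow_diff A.m_assoc\<close>)
    next
      case False
      have gv: "gen v \<in> carrier A" by (rule raag_gen_closed) fact
      let ?c = "gen z [^]\<^bsub>A\<^esub> k"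
      have "?c \<otimes>\<^bsub>A\<^esub> inv\<^bsub>A\<^esub> gen v \<otimes>\<^bsub>A\<^esub> inv\<^bsub>A\<^esub> ?c = inv\<^bsub>A\<^esub> (?c \<otimes>\<^bsub>A\<^esub> gen v \<otimes>\<^bsub>A\<^esub> inv\<^bsub>A\<^esub> ?c)"
        using gv gz by (simp add: A.inv_mult_group A.m_assoc)
      then have "?c \<otimes>\<^bsub>A\<^esub> inv\<^bsub>A\<^esub> gen v \<otimes>\<^bsub>A\<^esub> inv\<^bsub>A\<^esub> ?c \<in> ?H"
        using conj_in_generate[of v k] False inv_gen by simp
      then show ?thesis
        unfolding h(2) using h gv by (intro step) auto
    qed
  qed
qed

lemma kernel_eq_generate:
  assumes "vertex_hom \<Gamma> z n \<phi>"
  shows "kernel A (cyclic_presentation n) \<phi> = generate A (kernel_gens \<Gamma> z n)"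
proof
  let ?C = "cyclic_presentation n" and ?H = "generate A (kernel_gens \<Gamma> z n)"
  interpret C: group ?C by (rule group_cyclic_presentation)
  interpret \<phi>: group_hom A ?C \<phi>
    using assms by unfold_locales (simp add: vertex_hom_def)
  interpret H: subgroup ?H A by (rule subgroup_generate_kernel_gens)
  note gz = raag_gen_closed[OF z]
  have \<phi>z: "\<phi> (gen z) = cyclic_gen n" and \<phi>v: "\<And>v. v \<in> pverts \<Gamma> - {z} \<Longrightarrow> \<phi> (gen v) = \<one>\<^bsub>?C\<^esub>"
    using assms by (auto simp: vertex_hom_def)
  have "\<phi> (kernel_gen v) = \<one>\<^bsub>?C\<^esub>" if "v \<in> pverts \<Gamma>'" for v
  proof (cases v)
    case (Base w)
    then show ?thesis
      using that gz by (auto simp: base_pverts star_def \<phi>.hom_nat_pow \<phi>z cyclic_gen_pow_order \<phi>v link_pverts)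
  next
    case (Copy k u)
    then have "u \<in> pverts \<Gamma> - {z}" using that by (auto simp: copy_pverts star_def)
    then show ?thesis
      using Copy gz by (simp add: conj_gen_def raag_gen_closed \<phi>v)
  qed
  then have "kernel_gens \<Gamma> z n \<subseteq> kernel A ?C \<phi>"
    by (auto simp: kernel_gens_eq kernel_def kernel_gen_closed)
  then show H: "?H \<subseteq> kernel A ?C \<phi>"
    by (rule A.generate_subgroup_incl[OF _ \<phi>.subgroup_kernel])
  show "kernel A ?C \<phi> \<subseteq> ?H"
  proof
    fix g assume g: "g \<in> kernel A ?C \<phi>"
    then obtain h and k :: int where h: "h \<in> ?H" "g = h \<otimes>\<^bsub>A\<^esub> gen z [^]\<^bsub>A\<^esub> k"
      using generate_times_powers[of g] by (auto simp: kernel_def)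
    have "\<phi> h = \<one>\<^bsub>?C\<^esub>" using h(1) H by (auto simp: kernel_def)
    then have "cyclic_gen n [^]\<^bsub>?C\<^esub> k = \<one>\<^bsub>?C\<^esub>"
      using g h gz by (simp add: kernel_def \<phi>.hom_int_pow \<phi>z cyclic_gen_closed)
    then obtain q where "k = int n * q"
      using cyclic_gen_pow_eq_one_iff[OF n] by blast
    then have "gen z [^]\<^bsub>A\<^esub> k = (gen z [^]\<^bsub>A\<^esub> n) [^]\<^bsub>A\<^esub> q"
      using gz by (simp add: A.int_pow_pow[symmetric] int_pow_int)
    moreover have "(gen z [^]\<^bsub>A\<^esub> n) [^]\<^bsub>A\<^esub> q \<in> ?H"
      by (rule A.subgroup_int_pow_closed[OF subgroup_generate_kernel_gens])
        (auto simp: kernel_gens_def intro: generate.incl)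
    ultimately show "g \<in> ?H" using h by simp
  qed
qed

lemma gluing_iso:
  assumes \<phi>: "vertex_hom \<Gamma> z n \<phi>"
    and \<psi>: "\<psi> \<in> hom B A" and \<psi>_gen: "\<And>v. v \<in> pverts \<Gamma>' \<Longrightarrow> \<psi> (gen' v) = kernel_gen v"
  shows "\<psi> \<in> iso B (A\<lparr>carrier := kernel A (cyclic_presentation n) \<phi>\<rparr>)"
proof -
  have image: "\<psi> ` carrier B = kernel A (cyclic_presentation n) \<phi>"
    using generate_kernel_gens_eq_image[OF \<psi> \<psi>_gen] kernel_eq_generate[OF \<phi>] by simp
  then have "\<psi> \<in> hom B (A\<lparr>carrier := kernel A (cyclic_presentation n) \<phi>\<rparr>)"
    using \<psi> by (auto simp: hom_def)
  moreover have "bij_betw \<psi> (carrier B) (kernel A (cyclic_presentation n) \<phi>)"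
    using gluing_hom_inj[OF \<psi> \<psi>_gen] image by (simp add: bij_betw_def)
  ultimately show ?thesis by (simp add: iso_def)
qed

lemma bij_betw_kernel_gens:
  assumes \<psi>: "\<psi> \<in> hom B A" and \<psi>_gen: "\<And>v. v \<in> pverts \<Gamma>' \<Longrightarrow> \<psi> (gen' v) = kernel_gen v"
  shows "bij_betw (\<lambda>v. \<psi> (gen' v)) (pverts \<Gamma>') (kernel_gens \<Gamma> z n)"
proof -
  have "inj_on (\<psi> \<circ> gen') (pverts \<Gamma>')"
    by (intro comp_inj_on inj_on_raag_gen inj_on_subset[OF gluing_hom_inj[OF \<psi> \<psi>_gen]])
      (auto simp: raag_gen_closed)
  then show ?thesis
    by (simp add: bij_betw_def kernel_gens_eq \<psi>_gen comp_def)
qed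

end

theorem lemma1:
  fixes \<Gamma> :: "'a pair_pre_digraph" and z :: 'a and n :: nat
  assumes "pair_graph \<Gamma>" and "z \<in> pverts \<Gamma>" and "n \<ge> 1"
  shows "cyclic_presentation n \<cong> integer_mod_group n \<and>
    (\<exists>\<phi>. vertex_hom \<Gamma> z n \<phi>) \<and>
    (\<forall>\<phi>. vertex_hom \<Gamma> z n \<phi> \<longrightarrow>
      generate (raag \<Gamma>) (kernel_gens \<Gamma> z n) = kernel (raag \<Gamma>) (cyclic_presentation n) \<phi> \<and>
      (\<exists>\<psi> \<in> iso (raag (glue_copies \<Gamma> z n))
               ((raag \<Gamma>)\<lparr>carrier := kernel (raag \<Gamma>) (cyclic_presentation n) \<phi>\<rparr>).
        bij_betw (\<lambda>v. \<psi> (raag_gen (glue_copies \<Gamma> z n) v))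
          (pverts (glue_copies \<Gamma> z n)) (kernel_gens \<Gamma> z n) \<and>
        \<psi> (raag_gen (glue_copies \<Gamma> z n) (Base z)) = raag_gen \<Gamma> z [^]\<^bsub>raag \<Gamma>\<^esub> n \<and>
        (\<forall>v \<in> link \<Gamma> z. \<psi> (raag_gen (glue_copies \<Gamma> z n) (Base v)) = raag_gen \<Gamma> v) \<and>
        (\<forall>k < n. \<forall>u \<in> pverts \<Gamma> - star \<Gamma> z.
          \<psi> (raag_gen (glue_copies \<Gamma> z n) (Copy k u)) = conj_gen \<Gamma> z k u)))"
proof (intro conjI allI impI)
  interpret star_gluing \<Gamma> z n
    using assms by (intro star_gluing.intro star_gluing_axioms.intro)
  show "cyclic_presentation n \<cong> integer_mod_group n"
    by (rule cyclic_presentation_iso[OF assms(3)])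
  show "\<exists>\<phi>. vertex_hom \<Gamma> z n \<phi>"
    by (rule vertex_hom_exists[OF assms(2,1)])
  fix \<phi> assume \<phi>: "vertex_hom \<Gamma> z n \<phi>"
  show "generate A (kernel_gens \<Gamma> z n) = kernel A (cyclic_presentation n) \<phi>"
    by (rule kernel_eq_generate[OF \<phi>, symmetric])
  obtain \<psi> where \<psi>: "\<psi> \<in> hom B A"
    and \<psi>_gen: "\<And>v. v \<in> pverts \<Gamma>' \<Longrightarrow> \<psi> (gen' v) = kernel_gen v"
    by (rule gluing_hom_exists) blast
  show "\<exists>\<psi> \<in> iso B (A\<lparr>carrier := kernel A (cyclic_presentation n) \<phi>\<rparr>).
      bij_betw (\<lambda>v. \<psi> (gen' v)) (pverts \<Gamma>') (kernel_gens \<Gamma> z n) \<and>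
      \<psi> (gen' (Base z)) = gen z [^]\<^bsub>A\<^esub> n \<and>
      (\<forall>v \<in> link \<Gamma> z. \<psi> (gen' (Base v)) = gen v) \<and>
      (\<forall>k < n. \<forall>u \<in> pverts \<Gamma> - star \<Gamma> z. \<psi> (gen' (Copy k u)) = conj_gen \<Gamma> z k u)"
  proof (intro bexI[of _ \<psi>] conjI ballI allI impI)
    show "\<psi> \<in> iso B (A\<lparr>carrier := kernel A (cyclic_presentation n) \<phi>\<rparr>)"
      by (rule gluing_iso[OF \<phi> \<psi> \<psi>_gen])
    show "bij_betw (\<lambda>v. \<psi> (gen' v)) (pverts \<Gamma>') (kernel_gens \<Gamma> z n)"
      by (rule bij_betw_kernel_gens[OF \<psi> \<psi>_gen])
    show "\<psi> (gen' (Base z)) = gen z [^]\<^bsub>A\<^esub> n"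
      by (simp add: \<psi>_gen base_pverts star_def)
    show "\<psi> (gen' (Base v)) = gen v" if "v \<in> link \<Gamma> z" for v
      using that z_notin_link by (auto simp: \<psi>_gen base_pverts star_def)
    show "\<psi> (gen' (Copy k u)) = conj_gen \<Gamma> z k u" if "k < n" "u \<in> pverts \<Gamma> - star \<Gamma> z" for k u
      using that by (simp add: \<psi>_gen copy_pverts)
  qed
qed

end
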